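(* Let $n\ge 1$ and fix an integer $s$ with $1\le s\le n-4$. Any odd-sized family $\mathcal A\subset 2^{[n]}$ with $|\mathcal A|\ge n+s$ must satisfy $op(\mathcal A)\ge s+2$, and this lower bound is tight (i.e. for all such $n,s$ there is an odd-sized family $\mathcal A\subset 2^{[n]}$ with $|\mathcal A|\ge n+s$ and $op(\mathcal A)=s+2$).
   Context: $[n]=\{1,2,\ldots,n\}$ and $2^{[n]}$ is the collection of all subsets of $[n]$. A family $\mathcal A\subset 2^{[n]}$ is a set of (distinct) subsets of $[n]$; it is odd-sized if every member has odd cardinality. The odd pair number $op(\mathcal A)$ is the number of (unordered) pairs of distinct members $A,B\in\mathcal A$ such that $|A\cap B|$ is odd. *)

theory Defs
  imports Main
begin

definition odd_sized :: "nat set set \<Rightarrow> bool" where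
  "odd_sized F \<longleftrightarrow> (\<forall>A\<in>F. odd (card A))"

text \<open>The pairs counted are unordered: each one is the two-element set \<open>{A, B}\<close>.\<close>

definition odd_pair_number :: "nat set set \<Rightarrow> nat" where
  "odd_pair_number F =
     card {{A, B} | A B. A \<in> F \<and> B \<in> F \<and> A \<noteq> B \<and> odd (card (A \<inter> B))}"

end

theory Submission
  imports Defs
begin

text \<open>
  Sets are read as vectors over the two-element field, so that symmetric difference is addition and
  the parity of \<open>card (A \<inter> B)\<close> is the standard bilinear form; orthogonality refers to this form. The
  odd pairs are the edges of a graph on the family, in which every member is a vector with
  \<open>A \<cdot> A = 1\<close>.

  For the lower bound, assume that there are at most \<open>s + 1\<close> edges. Deleting an endpoint of each edge
  leaves an orthonormal family of at least \<open>n - 1\<close> members. Since more than \<open>n\<close> independent vectors are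
  impossible (\<open>card_le_if_odd_pairing\<close>), two more independent vectors give a contradiction. They are
  found in one of two ways, unless there are no edges at all and the whole family is orthonormal.

  If two distinct members \<open>A\<close>, \<open>B\<close> have the same products with all members, then \<open>x = A + B\<close> is a
  nonzero vector orthogonal to itself and to the whole family. Some coordinate vector \<open>c\<close> has
  \<open>c \<cdot> x = 1\<close>, and the remaining orthonormal family together with \<open>x\<close> and \<open>c\<close> is independent
  (\<open>card_orthonormal_with_isotropic\<close>).

  If there are no such members, the two ends of an edge are told apart by a third member, which gives
  an induced path on three vertices. The Gram matrix of such a path is nonsingular, so its two
  edges need no deletion: at most \<open>s - 1\<close> members are deleted, and at least \<open>n + 1\<close>
  independent vectors remain (\<open>card_orthonormal_with_path\<close>).

  For tightness, the first situation is realised: take \<open>x = {1,2,3,4}\<close> and lift an orthonormal basis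
  of \<open>x\<^sup>\<bottom> / x\<close>, of size \<open>n - 2\<close>. Adding to it the translates by \<open>x\<close> of \<open>s + 2\<close> of its
  vectors creates just the edges between a vector and its translate.
\<close>

section \<open>Linear independence modulo two\<close>

text \<open>
  The hypothesis forces linear independence: a vanishing subfamily sum would have product zero with
  every \<open>B\<close>. Hence the \<open>2 ^ card T\<close> subfamilies have distinct sums among the \<open>2 ^ card X\<close> subsets of
  \<open>X\<close>.
\<close>

lemma card_le_if_odd_pairing:
  fixes X :: "'a set"
  assumes "finite X" and "T \<subseteq> Pow X"
    and pairing: "\<And>U. U \<subseteq> T \<Longrightarrow> U \<noteq> {} \<Longrightarrow> \<exists>B\<subseteq>X. odd (card {A \<in> U. odd (card (A \<inter> B))})"
  shows "card T \<le> card X"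
proof -
  have finT: "finite T"
    using assms(1,2) by (meson finite_Pow_iff finite_subset)
  define \<sigma> where "\<sigma> U = {x \<in> X. odd (card {A \<in> U. x \<in> A})}" for U
  have "inj_on \<sigma> (Pow T)"
  proof (rule inj_onI)
    fix U V assume U: "U \<in> Pow T" and V: "V \<in> Pow T" and eq: "\<sigma> U = \<sigma> V"
    have fin: "finite U" "finite V"
      using U V finT by (auto intro: finite_subset)
    define W where "W = (U - V) \<union> (V - U)"
    have finW: "finite W"
      using fin by (simp add: W_def)
    have even_W: "even (card {A \<in> W. x \<in> A})" if "x \<in> X" for x
    proof -
      have "{A \<in> W. x \<in> A} = ({A \<in> U. x \<in> A} - {A \<in> V. x \<in> A}) \<union> ({A \<in> V. x \<in> A} - {A \<in> U. x \<in> A})"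
        by (auto simp: W_def)
      moreover have "card (P - Q \<union> (Q - P)) + 2 * card (P \<inter> Q) = card P + card Q"
        if "finite P" "finite Q" for P Q :: "'a set set"
      proof -
        have "card (P - Q \<union> (Q - P)) = card (P - Q) + card (Q - P)"
          using that by (intro card_Un_disjoint) auto
        moreover have "card P = card (P \<inter> Q) + card (P - Q)" "card Q = card (P \<inter> Q) + card (Q - P)"
          using that card_Int_Diff[of P Q] card_Int_Diff[of Q P] by (simp_all add: Int_commute)
        ultimately show ?thesis by simp
      qed
      ultimately have "card {A \<in> W. x \<in> A} + 2 * card ({A \<in> U. x \<in> A} \<inter> {A \<in> V. x \<in> A})
          = card {A \<in> U. x \<in> A} + card {A \<in> V. x \<in> A}"
        using fin by simp
      moreover have "even (card {A \<in> U. x \<in> A} + card {A \<in> V. x \<in> A})"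
        using eq that by (auto simp: \<sigma>_def set_eq_iff)
      ultimately have "even (card {A \<in> W. x \<in> A} + 2 * card ({A \<in> U. x \<in> A} \<inter> {A \<in> V. x \<in> A}))"
        by (simp only:)
      then show ?thesis
        by simp
    qed
    have "W = {}"
    proof (rule ccontr)
      assume "W \<noteq> {}"
      moreover have "W \<subseteq> T"
        using U V by (auto simp: W_def)
      ultimately obtain B where B: "B \<subseteq> X" "odd (card {A \<in> W. odd (card (A \<inter> B))})"
        using pairing by blast
      have finB: "finite B"
        using B(1) assms(1) finite_subset by blast
      have "(\<Sum>A\<in>W. card (A \<inter> B)) = (\<Sum>A\<in>W. \<Sum>x\<in>{x \<in> B. x \<in> A}. 1)"
        by (intro sum.cong) (auto intro!: arg_cong[where f = card])
      also have "\<dots> = (\<Sum>x\<in>B. \<Sum>A\<in>{A \<in> W. x \<in> A}. 1)"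
        by (rule sum.swap_restrict[OF finW finB])
      also have "\<dots> = (\<Sum>x\<in>B. card {A \<in> W. x \<in> A})"
        by simp
      finally have "even (\<Sum>A\<in>W. card (A \<inter> B))"
        using even_W B(1) by (auto intro: dvd_sum)
      then show False
        using B(2) by (simp add: even_sum_iff[OF finW])
    qed
    then show "U = V"
      by (auto simp: W_def)
  qed
  moreover have "\<sigma> ` Pow T \<subseteq> Pow X"
    by (auto simp: \<sigma>_def)
  ultimately have "card (Pow T) \<le> card (Pow X)"
    using assms(1) by (meson card_inj_on_le finite_Pow_iff)
  then show ?thesis
    using assms(1) finT by (simp add: card_Pow)
qed

section \<open>Few edges leave a large independent set\<close>

text \<open>
  One vertex outside \<open>P\<close> is deleted from each edge. The protected set \<open>P\<close> is there to keep an induced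
  path whose own edges are not counted in \<open>E\<close>.
\<close>

lemma card_hitting_set_complement:
  fixes F :: "'a set"
  assumes "finite F" and "finite E" and "P \<subseteq> F" and "\<And>e. e \<in> E \<Longrightarrow> \<not> e \<subseteq> P"
  obtains S where "P \<subseteq> S" and "S \<subseteq> F" and "card F \<le> card S + card E"
    and "\<And>e. e \<in> E \<Longrightarrow> \<not> e \<subseteq> S"
proof -
  define h where "h e = (SOME a. a \<in> e - P)" for e
  have h: "h e \<in> e - P" if "e \<in> E" for e
  proof -
    have "\<exists>a. a \<in> e - P"
      using assms(4)[OF that] by blast
    then show ?thesis
      unfolding h_def by (rule someI_ex)
  qed
  show thesis
  proof (rule that)
    show "P \<subseteq> F - h ` E" "F - h ` E \<subseteq> F"
      using assms(3) h by auto
    have "card F - card (h ` E) \<le> card (F - h ` E)"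
      using assms(2) by (intro diff_card_le_card_Diff) simp
    then show "card F \<le> card (F - h ` E) + card E"
      using card_image_le[OF assms(2), of h] by linarith
    show "\<And>e. e \<in> E \<Longrightarrow> \<not> e \<subseteq> F - h ` E"
      using h by blast
  qed
qed

definition odd_pairs :: "nat set set \<Rightarrow> nat set set set" where
  "odd_pairs F = {{A, B} | A B. A \<in> F \<and> B \<in> F \<and> A \<noteq> B \<and> odd (card (A \<inter> B))}"

lemma odd_pair_number_eq: "odd_pair_number F = card (odd_pairs F)"
  by (simp add: odd_pair_number_def odd_pairs_def)

lemma finite_odd_pairs: "finite F \<Longrightarrow> finite (odd_pairs F)"
  by (rule finite_subset[of _ "Pow F"]) (auto simp: odd_pairs_def)

lemma odd_pairs_iff:
  assumes "A \<in> F" "B \<in> F" "A \<noteq> B"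
  shows "{A, B} \<in> odd_pairs F \<longleftrightarrow> odd (card (A \<inter> B))"
  using assms by (auto simp: odd_pairs_def doubleton_eq_iff Int_commute)

section \<open>The lower bound\<close>

text \<open>
  In the application, \<open>x\<close> is the sum of two members that the family cannot tell apart. The products with \<open>x\<close>,
  with the members of \<open>S\<close>, and with \<open>{p}\<close> show in this order that a vanishing combination of \<open>S\<close>, \<open>x\<close> and
  \<open>{p}\<close> does not use \<open>{p}\<close>, any member of \<open>S\<close>, or \<open>x\<close>.
\<close>

lemma card_orthonormal_with_isotropic:
  fixes X :: "'a set"
  assumes "finite X" and "S \<subseteq> Pow X"
    and unit: "\<And>A. A \<in> S \<Longrightarrow> odd (card A)"
    and orth: "\<And>A B. A \<in> S \<Longrightarrow> B \<in> S \<Longrightarrow> A \<noteq> B \<Longrightarrow> even (card (A \<inter> B))"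
    and "x \<subseteq> X" and "x \<noteq> {}" and "even (card x)"
    and orth_x: "\<And>A. A \<in> S \<Longrightarrow> even (card (A \<inter> x))"
  shows "card S + 2 \<le> card X"
proof -
  obtain p where p: "p \<in> x"
    using \<open>x \<noteq> {}\<close> by blast
  have ne: "x \<notin> S" "{p} \<notin> S" "x \<noteq> {p}"
    using unit[of x] orth_x[of "{p}"] p \<open>even (card x)\<close> by auto
  have finS: "finite S"
    using assms(1,2) by (meson finite_Pow_iff finite_subset)
  have "card (insert {p} (insert x S)) \<le> card X"
  proof (rule card_le_if_odd_pairing[OF \<open>finite X\<close>])
    show "insert {p} (insert x S) \<subseteq> Pow X"
      using assms p by auto
    fix U assume U: "U \<subseteq> insert {p} (insert x S)" "U \<noteq> {}"
    consider "{p} \<in> U" | A where "{p} \<notin> U" "A \<in> S" "A \<in> U" | "U = {x}"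
      using U by blast
    then show "\<exists>B\<subseteq>X. odd (card {A \<in> U. odd (card (A \<inter> B))})"
    proof cases
      case 1
      have "{A \<in> U. odd (card (A \<inter> x))} = {{p}}"
        using 1 U(1) orth_x p \<open>even (card x)\<close> by auto
      then show ?thesis
        using \<open>x \<subseteq> X\<close> by (intro exI[of _ x]) simp
    next
      case 2
      have "odd (card (A' \<inter> A)) \<longleftrightarrow> A' = A" if "A' \<in> U" for A'
      proof -
        have "A' = x \<or> A' \<in> S"
          using that U(1) 2(1) by blast
        then show ?thesis
          using orth[of A' A] orth_x[of A] unit[of A] 2(2) ne(1) by (metis Int_absorb Int_commute)
      qed
      then have "{A' \<in> U. odd (card (A' \<inter> A))} = {A}"
        using 2(3) by blast
      then show ?thesis
        using 2 assms(2) by (intro exI[of _ A]) auto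
    next
      case 3
      have "{A \<in> U. odd (card (A \<inter> {p}))} = {x}"
        using 3 p by auto
      then show ?thesis
        using p \<open>x \<subseteq> X\<close> by (intro exI[of _ "{p}"]) auto
    qed
  qed
  then show ?thesis
    using ne finS by simp
qed

text \<open>
  A path on three vertices has nonsingular Gram matrix modulo two. For a combination of
  \<open>w\<close>, \<open>u\<close>, \<open>v\<close> this is seen from the products with the two ends, which make the three coefficients
  equal, and then from the product with the middle \<open>u\<close>.
\<close>

lemma card_orthonormal_with_path:
  fixes X :: "'a set"
  assumes "finite X" and "S \<subseteq> Pow X"
    and unit: "\<And>A. A \<in> S \<Longrightarrow> odd (card A)"
    and path: "w \<in> S" "u \<in> S" "v \<in> S"
      "odd (card (w \<inter> u))" "odd (card (u \<inter> v))" "even (card (w \<inter> v))"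
    and "w \<noteq> u" and "u \<noteq> v"
    and orth: "\<And>A B. A \<in> S \<Longrightarrow> B \<in> S \<Longrightarrow> A \<noteq> B \<Longrightarrow> {A, B} \<noteq> {w, u} \<Longrightarrow> {A, B} \<noteq> {u, v} \<Longrightarrow>
      even (card (A \<inter> B))"
  shows "card S \<le> card X"
proof (rule card_le_if_odd_pairing[OF assms(1,2)])
  fix U assume U: "U \<subseteq> S" "U \<noteq> {}"
  have "w \<noteq> v"
    using path unit[of v] by auto
  have row_w: "{A \<in> U. odd (card (A \<inter> w))} = U \<inter> {w, u}"
    using U path unit[of w] orth[of _ w] \<open>u \<noteq> v\<close> \<open>w \<noteq> v\<close>
    by (auto simp: Int_commute doubleton_eq_iff)
  have row_v: "{A \<in> U. odd (card (A \<inter> v))} = U \<inter> {u, v}"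
    using U path unit[of v] orth[of _ v] \<open>w \<noteq> u\<close> \<open>w \<noteq> v\<close>
    by (auto simp: Int_commute doubleton_eq_iff)
  have row_u: "{A \<in> U. odd (card (A \<inter> u))} = U \<inter> {w, u, v}"
    using U path unit[of u] orth[of _ u]
    by (auto simp: Int_commute doubleton_eq_iff)
  have row: "{B \<in> U. odd (card (B \<inter> A))} = {A}" if "A \<in> U" "A \<notin> {w, u, v}" for A
    using that U unit[of A] orth[of _ A] by (auto simp: doubleton_eq_iff)
  consider A where "A \<in> U" "A \<notin> {w, u, v}" | "w \<in> U \<longleftrightarrow> u \<notin> U" | "u \<in> U \<longleftrightarrow> v \<notin> U" | "U = {w, u, v}"
    using U(2) by blast
  then show "\<exists>B\<subseteq>X. odd (card {A \<in> U. odd (card (A \<inter> B))})"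
  proof cases
    case 1
    then show ?thesis
      using row[OF 1] U assms(2) by (intro exI[of _ A]) auto
  next
    case 2
    then have "U \<inter> {w, u} = {w} \<or> U \<inter> {w, u} = {u}" by auto
    then show ?thesis
      using row_w path assms(2) by (intro exI[of _ w]) auto
  next
    case 3
    then have "U \<inter> {u, v} = {u} \<or> U \<inter> {u, v} = {v}" by auto
    then show ?thesis
      using row_v path assms(2) by (intro exI[of _ v]) auto
  next
    case 4
    then have "card (U \<inter> {w, u, v}) = 3"
      using \<open>w \<noteq> u\<close> \<open>u \<noteq> v\<close> \<open>w \<noteq> v\<close> by simp
    then have "odd (card {A \<in> U. odd (card (A \<inter> u))})"
      by (simp only: row_u) simp
    then show ?thesis
      using path(2) assms(2) by blast
  qed
qed

lemma even_card_Int_sym_diff: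
  assumes "finite A" and "finite B"
  shows "even (card (C \<inter> ((A - B) \<union> (B - A)))) \<longleftrightarrow> (odd (card (A \<inter> C)) \<longleftrightarrow> odd (card (B \<inter> C)))"
proof -
  have "card (C \<inter> ((A - B) \<union> (B - A))) = card (A \<inter> C - B) + card (B \<inter> C - A)"
  proof -
    have "C \<inter> ((A - B) \<union> (B - A)) = (A \<inter> C - B) \<union> (B \<inter> C - A)"
      by blast
    then show ?thesis
      using assms by (simp only:) (rule card_Un_disjoint; blast)
  qed
  moreover have "card (A \<inter> C) = card (A \<inter> C \<inter> B) + card (A \<inter> C - B)"
    using assms by (intro card_Int_Diff) auto
  moreover have "card (B \<inter> C) = card (A \<inter> C \<inter> B) + card (B \<inter> C - A)"
    using assms card_Int_Diff[of "B \<inter> C" A] by (simp add: Int_ac)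
  ultimately show ?thesis by auto
qed

theorem odd_pair_number_lower_bound:
  assumes F: "F \<subseteq> Pow {1..n}" and odd: "odd_sized F" and card: "n + s \<le> card F" and "1 \<le> s"
  shows "s + 2 \<le> odd_pair_number F"
proof (rule ccontr)
  assume "\<not> s + 2 \<le> odd_pair_number F"
  then have few: "card (odd_pairs F) \<le> s + 1"
    by (simp add: odd_pair_number_eq)
  have finF: "finite F"
    using F by (meson finite_Pow_iff finite_atLeastAtMost finite_subset)
  have fin: "finite A" if "A \<in> F" for A
    using F that by (meson PowD finite_atLeastAtMost finite_subset subsetD)
  have unit: "odd (card A)" if "A \<in> F" for A
    using odd that by (simp add: odd_sized_def)
  obtain S where S: "S \<subseteq> F" "card F \<le> card S + card (odd_pairs F)"
      "\<And>e. e \<in> odd_pairs F \<Longrightarrow> \<not> e \<subseteq> S"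
    by (rule card_hitting_set_complement[OF finF finite_odd_pairs[OF finF], of "{}"])
      (auto simp: odd_pairs_def)
  have SX: "S \<subseteq> Pow {1..n}"
    using S(1) F by blast
  have orth: "even (card (A \<inter> B))" if "A \<in> S" "B \<in> S" "A \<noteq> B" for A B
    using S(3)[of "{A, B}"] odd_pairs_iff[of A F B] that S(1) by auto
  show False
  proof (cases "\<exists>A\<in>F. \<exists>B\<in>F. A \<noteq> B \<and> (\<forall>C\<in>F. odd (card (A \<inter> C)) \<longleftrightarrow> odd (card (B \<inter> C)))")
    case True
    then obtain A B where AB: "A \<in> F" "B \<in> F" "A \<noteq> B"
      and twins: "\<And>C. C \<in> F \<Longrightarrow> odd (card (A \<inter> C)) \<longleftrightarrow> odd (card (B \<inter> C))"
      by blast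
    define x where "x = (A - B) \<union> (B - A)"
    have orth_x: "even (card (C \<inter> x))" if "C \<in> F" for C
      using even_card_Int_sym_diff[of A B C] twins[OF that] AB fin by (simp add: x_def)
    have "even (card x)"
    proof -
      have "even (card (A \<inter> x)) \<and> even (card (B \<inter> x))"
        using orth_x AB by blast
      moreover have "card x = card (A \<inter> x) + card (B \<inter> x)"
      proof -
        have "x = (A \<inter> x) \<union> (B \<inter> x)" "(A \<inter> x) \<inter> (B \<inter> x) = {}"
          by (auto simp: x_def)
        then show ?thesis
          using card_Un_disjoint[of "A \<inter> x" "B \<inter> x"] AB fin by simp
      qed
      ultimately show ?thesis by simp
    qed
    then have "card S + 2 \<le> card {1..n}"
      using AB F S(1) SX unit orth orth_x
      by (intro card_orthonormal_with_isotropic[of _ S x]) (auto simp: x_def)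
    then show False
      using S(2) few card by simp
  next
    case no_twins: False
    show False
    proof (cases "odd_pairs F = {}")
      case True
      have "card S \<le> card {1..n}"
      proof (rule card_le_if_odd_pairing)
        fix U assume U: "U \<subseteq> S" "U \<noteq> {}"
        then obtain A where A: "A \<in> U" by blast
        then have "{B \<in> U. odd (card (B \<inter> A))} = {A}"
          using U orth[of _ A] unit[of A] S(1) by auto
        then show "\<exists>B\<subseteq>{1..n}. odd (card {A \<in> U. odd (card (A \<inter> B))})"
          using A U SX by (intro exI[of _ A]) auto
      qed (use SX in auto)
      then show False
        using S(2) True card \<open>1 \<le> s\<close> by simp
    next
      case False
      then obtain a b where ab: "a \<in> F" "b \<in> F" "a \<noteq> b" "odd (card (a \<inter> b))"
        by (auto simp: odd_pairs_def)
      then obtain w where w: "w \<in> F" "odd (card (a \<inter> w)) \<longleftrightarrow> even (card (b \<inter> w))"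
        using no_twins by blast
      \<comment> \<open>The middle of the path is the end of the edge that is adjacent to \<open>w\<close>.\<close>
      obtain u v where uv: "u \<in> F" "v \<in> F" "u \<noteq> v"
        "odd (card (w \<inter> u))" "odd (card (u \<inter> v))" "even (card (w \<inter> v))"
        using ab w by (metis Int_commute)
      have "w \<noteq> u" "w \<noteq> v"
        using uv unit[of v] by auto
      define E where "E = odd_pairs F - {{w, u}, {u, v}}"
      have "{w, u} \<in> odd_pairs F" "{u, v} \<in> odd_pairs F" "{w, u} \<noteq> {u, v}"
        using uv w(1) \<open>w \<noteq> u\<close> \<open>w \<noteq> v\<close> by (auto simp: odd_pairs_iff doubleton_eq_iff)
      then have "card E + 2 = card (odd_pairs F)"
        using finite_odd_pairs[OF finF] card_Diff_subset[of "{{w, u}, {u, v}}" "odd_pairs F"]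
          card_mono[of "odd_pairs F" "{{w, u}, {u, v}}"]
        by (simp add: E_def)
      have not_path: "\<not> e \<subseteq> {w, u, v}" if "e \<in> E" for e
      proof
        assume sub: "e \<subseteq> {w, u, v}"
        obtain A B where e: "e = {A, B}" "A \<noteq> B" "odd (card (A \<inter> B))"
          using \<open>e \<in> E\<close> unfolding E_def odd_pairs_def by blast
        have "A \<in> {w, u, v}" "B \<in> {w, u, v}"
          using sub e(1) by simp_all
        then have "e = {w, u} \<or> e = {u, v} \<or> e = {w, v}"
          using e(2) unfolding e(1) by (elim insertE emptyE; simp add: insert_commute)
        moreover have "e \<noteq> {w, v}"
          using e(1,3) uv(6) by (metis Int_commute doubleton_eq_iff)
        ultimately show False
          using \<open>e \<in> E\<close> by (auto simp: E_def)
      qed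
      obtain R where R: "{w, u, v} \<subseteq> R" "R \<subseteq> F" "card F \<le> card R + card E"
          "\<And>e. e \<in> E \<Longrightarrow> \<not> e \<subseteq> R"
        using card_hitting_set_complement[of F E "{w, u, v}"] not_path finF uv(1,2) w(1)
          finite_odd_pairs[OF finF] by (auto simp: E_def)
      have "card R \<le> card {1..n}"
      proof (rule card_orthonormal_with_path[OF _ _ _ _ _ _ uv(4-6) \<open>w \<noteq> u\<close> uv(3)])
        show "finite {1..n}"
          by simp
        show "R \<subseteq> Pow {1..n}"
          using R(2) F by (rule subset_trans)
        show "w \<in> R" "u \<in> R" "v \<in> R"
          using R(1) by simp_all
        show "\<And>A. A \<in> R \<Longrightarrow> odd (card A)"
          using R(2) unit by blast
        fix A B assume AB: "A \<in> R" "B \<in> R" "A \<noteq> B" "{A, B} \<noteq> {w, u}" "{A, B} \<noteq> {u, v}"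
        then have "{A, B} \<notin> E"
          using R(4)[of "{A, B}"] by blast
        then have "{A, B} \<notin> odd_pairs F"
          using AB(4,5) unfolding E_def by blast
        moreover have "A \<in> F" "B \<in> F"
          using AB(1,2) R(2) by blast+
        ultimately show "even (card (A \<inter> B))"
          using odd_pairs_iff[of A F B] AB(3) by simp
      qed
      then show False
        using R(3) few card \<open>card E + 2 = card (odd_pairs F)\<close> by simp
    qed
  qed
qed

section \<open>A family attaining the bound\<close>

text \<open>
  The indices \<open>j \<notin> {4, 5}\<close> number an orthonormal basis of the quotient of the orthogonal complement of
  \<open>{1,2,3,4}\<close> by its span. On the even subsets of \<open>{1,2,3,4}\<close> the form is alternating, and only the
  coordinate \<open>5\<close> makes an orthonormal basis possible; this is why \<open>n \<ge> 5\<close> is needed.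
\<close>

definition basis_vector :: "nat \<Rightarrow> nat set" where
  "basis_vector j = (if j \<le> 3 then {j, 4, 5} else {j})"

text \<open>The symmetric difference of the basis vector with \<open>{1,2,3,4}\<close>.\<close>

definition translate :: "nat \<Rightarrow> nat set" where
  "translate j = (if j \<le> 3 then {1, 2, 3, 5} - {j} else {1, 2, 3, 4, j})"

lemma index_cases:
  fixes j :: nat
  assumes "1 \<le> j" and "j \<notin> {4, 5}"
  obtains "j = 1" | "j = 2" | "j = 3" | "6 \<le> j"
proof -
  have "j = 1 \<or> j = 2 \<or> j = 3 \<or> 6 \<le> j"
    using assms by simp arith
  then show thesis
    using that by blast
qed

lemma odd_card_basis_translate:
  assumes "1 \<le> j" "j \<notin> {4, 5}" "1 \<le> k" "k \<notin> {4, 5}"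
  shows "odd (card (basis_vector j \<inter> basis_vector k)) \<longleftrightarrow> j = k"
    and "odd (card (basis_vector j \<inter> translate k)) \<longleftrightarrow> j = k"
    and "odd (card (translate j \<inter> translate k)) \<longleftrightarrow> j = k"
proof -
  show "odd (card (basis_vector j \<inter> basis_vector k)) \<longleftrightarrow> j = k"
    by (rule index_cases[OF assms(1,2)]; rule index_cases[OF assms(3,4)])
      (simp_all add: basis_vector_def translate_def insert_Diff_if Int_insert_left)
  show "odd (card (basis_vector j \<inter> translate k)) \<longleftrightarrow> j = k"
    by (rule index_cases[OF assms(1,2)]; rule index_cases[OF assms(3,4)])
      (simp_all add: basis_vector_def translate_def insert_Diff_if Int_insert_left)
  show "odd (card (translate j \<inter> translate k)) \<longleftrightarrow> j = k"
    by (rule index_cases[OF assms(1,2)]; rule index_cases[OF assms(3,4)])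
      (simp_all add: basis_vector_def translate_def insert_Diff_if Int_insert_left)
qed

lemma basis_vector_ne_translate:
  assumes "1 \<le> j" "j \<notin> {4, 5}"
  shows "basis_vector j \<noteq> translate j"
proof -
  have "4 \<in> basis_vector j \<longleftrightarrow> 4 \<notin> translate j"
    using assms by (simp add: basis_vector_def translate_def)
  then show ?thesis
    by metis
qed

theorem odd_pair_number_attained:
  assumes "s + 4 \<le> n" and "1 \<le> s"
  shows "\<exists>F\<subseteq>Pow {1..n}. odd_sized F \<and> card F = n + s \<and> odd_pair_number F = s + 2"
proof -
  define I where "I = {1..n} - {4, 5}"
  have I: "1 \<le> j" "j \<notin> {4, 5}" "j \<in> {1..n}" if "j \<in> I" for j
    using that by (auto simp: I_def)
  have cardI: "card I = n - 2" and finI: "finite I"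
    using assms by (auto simp: I_def card_Diff_subset)
  obtain J where J: "J \<subseteq> I" "card J = s + 2"
  proof -
    have "s + 2 \<le> card I"
      using assms cardI by simp
    then show thesis
      using obtain_subset_with_card_n that by blast
  qed
  have finJ: "finite J"
    using J finI finite_subset by blast
  have parity: "odd (card (basis_vector j \<inter> basis_vector k)) \<longleftrightarrow> j = k"
      "odd (card (basis_vector j \<inter> translate k)) \<longleftrightarrow> j = k"
      "odd (card (translate j \<inter> translate k)) \<longleftrightarrow> j = k" if "j \<in> I" "k \<in> I" for j k
    using odd_card_basis_translate[OF I(1,2)[OF that(1)] I(1,2)[OF that(2)]] .
  have unit: "odd (card (basis_vector j))" "odd (card (translate j))" if "j \<in> I" for j
    using parity(1,3)[OF that that] by simp_all
  have inj: "inj_on basis_vector I" "inj_on translate I"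
    using parity(1,3) unit by (metis (no_types, lifting) Int_absorb inj_onI)+
  have ne: "basis_vector j \<noteq> translate k" if "j \<in> I" "k \<in> I" for j k
  proof
    assume eq: "basis_vector j = translate k"
    then have "j = k"
      using parity(2)[OF that] unit(1)[OF that(1)] by simp
    then show False
      using eq basis_vector_ne_translate I that by blast
  qed
  define F where "F = basis_vector ` I \<union> translate ` J"
  have "F \<subseteq> Pow {1..n}"
    using I J assms by (fastforce simp: F_def basis_vector_def translate_def split: if_splits)
  moreover have "odd_sized F"
    using unit J by (auto simp: odd_sized_def F_def)
  moreover have "card F = n + s"
  proof -
    have "card F = card (basis_vector ` I) + card (translate ` J)"
      unfolding F_def using ne J finI finJ by (intro card_Un_disjoint) blast+
    also have "\<dots> = card I + card J"
      using inj J by (simp add: card_image inj_on_subset)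
    finally show ?thesis
      using cardI J(2) assms by simp
  qed
  moreover have "odd_pair_number F = s + 2"
  proof -
    have "odd_pairs F = (\<lambda>j. {basis_vector j, translate j}) ` J"
    proof (intro equalityI subsetI)
      fix e assume "e \<in> odd_pairs F"
      then obtain A B where e: "e = {A, B}" "A \<in> F" "B \<in> F" "A \<noteq> B" "odd (card (A \<inter> B))"
        by (auto simp: odd_pairs_def)
      obtain j where j: "j \<in> I" "A = basis_vector j \<or> A = translate j \<and> j \<in> J"
        using e(2) J by (auto simp: F_def)
      obtain k where k: "k \<in> I" "B = basis_vector k \<or> B = translate k \<and> k \<in> J"
        using e(3) J by (auto simp: F_def)
      have "j = k"
        using j k e(5) parity[OF j(1) k(1)] parity(2)[OF k(1) j(1)] by (auto simp: Int_commute)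
      then show "e \<in> (\<lambda>j. {basis_vector j, translate j}) ` J"
        using j k e(1,4) by auto
    next
      fix e assume "e \<in> (\<lambda>j. {basis_vector j, translate j}) ` J"
      then obtain j where j: "j \<in> J" "e = {basis_vector j, translate j}" by blast
      then show "e \<in> odd_pairs F"
        using J(1) ne[of j j] parity(2)[of j j] by (auto simp: odd_pairs_iff F_def)
    qed
    moreover have "inj_on (\<lambda>j. {basis_vector j, translate j}) J"
    proof (rule inj_onI)
      fix j k assume "j \<in> J" "k \<in> J"
        and "{basis_vector j, translate j} = {basis_vector k, translate k}"
      then show "j = k"
        using J(1) ne[of j k] inj(1) by (auto simp: doubleton_eq_iff dest: inj_onD)
    qed
    ultimately show ?thesis
      using J(2) by (simp add: odd_pair_number_eq card_image)
  qed
  ultimately show ?thesis by blast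
qed

theorem theorem1p2:
  fixes n s :: nat
  assumes "n \<ge> 1" and "1 \<le> s" and "s + 4 \<le> n"
  shows "(\<forall>F. F \<subseteq> Pow {1..n} \<and> odd_sized F \<and> card F \<ge> n + s \<longrightarrow> odd_pair_number F \<ge> s + 2)
       \<and> (\<exists>F. F \<subseteq> Pow {1..n} \<and> odd_sized F \<and> card F \<ge> n + s \<and> odd_pair_number F = s + 2)"
proof (intro conjI allI impI)
  fix F assume "F \<subseteq> Pow {1..n} \<and> odd_sized F \<and> card F \<ge> n + s"
  then show "odd_pair_number F \<ge> s + 2"
    using odd_pair_number_lower_bound assms(2) by blast
next
  show "\<exists>F. F \<subseteq> Pow {1..n} \<and> odd_sized F \<and> card F \<ge> n + s \<and> odd_pair_number F = s + 2"
    using odd_pair_number_attained[OF assms(3,2)] by (metis order_refl)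
qed

end
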